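(* Let $a_1>a_2>\cdots>a_m\ge 0$ and $0\le b_1<b_2<\cdots<b_m$ be two sequences of integers, where $m\ge 1$, and let $I:=(x_1^{a_1}x_2^{b_1},\ldots,x_1^{a_m}x_2^{b_m})\subset T_2$. Then: (1) If $a_1+b_1\le a_2+b_2\le\cdots\le a_m+b_m=:d$ and $d>0$, then $I$ is smoothly spreadable. (2) If $I$ is smoothly spreadable, then $a_2+b_2\le\cdots\le a_{m-1}+b_{m-1}$. Moreover, if $b_1>0$ then $a_1+b_1\le a_2+b_2$, and if $a_m>0$ then $a_{m-1}+b_{m-1}\le a_m+b_m$.
   Context: $K$ is a field, $T=K[x_1,x_2,\ldots]$ is the polynomial ring in countably many indeterminates and $T_n=K[x_1,\ldots,x_n]$. For a monomial $u=x_{i_1}\cdots x_{i_d}$ with $i_1\le\cdots\le i_d$, set $\sigma(u):=x_{i_1}x_{i_2+1}\cdots x_{i_d+d-1}$, and let $\sigma^t$ denote the $t$-fold iterate of $\sigma$, so $\sigma^t(u)=x_{i_1}x_{i_2+t}\cdots x_{i_d+(d-1)t}$. For a nonzero monomial ideal $I$, $G(I)$ is its set of minimal monomial generators and $\deg(I)$ is the maximal degree of an element of $G(I)$. For a monomial $u=x_1^{c_1}\cdots x_n^{c_n}\in T_n$, its polarization is $u^p:=\prod_{j=1}^n\prod_{k=0}^{c_j-1}x_{kn+j}$. A monomial ideal $I\subset T_n$ with $\deg(I)=d$ is called smoothly spreadable if there is a permutation $\tau$ of $\{1,\ldots,nd\}$ with $\tau(j)\equiv j\pmod n$ for all $1\le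 j\le nd$ such that the $K$-algebra isomorphism $\Phi:T_{nd}\to T_{nd}$, $\Phi(x_j)=x_{\tau(j)}$, satisfies $\Phi(\sigma^n(u))=u^p$ for all $u\in G(I)$.
   Formalization: In (2), the last claim (a_m>0 implies a_{m-1}+b_{m-1} ≤ a_m+b_m) is stated only for m≥3: for m=2, b_1=0 it fails, e.g. I=(x_1^5, x_1x_2) is smoothly spreadable but 5>2; for m=2, b_1>0 the other claim covers it. The claim on a_1+b_1 is stated for m≥2. *)

theory Defs
  imports
    "HOL-Library.Poly_Mapping"
    "HOL-Algebra.QuotRing"
    "HOL-Combinatorics.Permutations"
    "HOL-Number_Theory.Cong"
begin

text \<open>
  A monomial is its exponent vector, so multiplication of monomials is addition of exponent
  vectors. Indeterminates are numbered from 1; the index 0 is never used. The order of the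
  library on \<open>nat \<Rightarrow>\<^sub>0 nat\<close> is lexicographic and has nothing to do with divisibility.
\<close>

type_synonym monomial = "nat \<Rightarrow>\<^sub>0 nat"

type_synonym 'k polynomial = "monomial \<Rightarrow>\<^sub>0 'k"

definition mpoly_monom :: "monomial \<Rightarrow> 'k::field polynomial" where
  "mpoly_monom u = Poly_Mapping.single u 1"

definition scalar :: "'k::field \<Rightarrow> 'k polynomial" where
  "scalar c = Poly_Mapping.single 0 c"

definition var :: "nat \<Rightarrow> 'k::field polynomial" where
  "var i = mpoly_monom (Poly_Mapping.single i 1)"

definition monomials :: "nat \<Rightarrow> monomial set" where
  "monomials n = {u. Poly_Mapping.keys u \<subseteq> {1..n}}"

definition mdvd :: "monomial \<Rightarrow> monomial \<Rightarrow> bool" where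
  "mdvd u v \<longleftrightarrow> (\<forall>i. Poly_Mapping.lookup u i \<le> Poly_Mapping.lookup v i)"

definition mdeg :: "monomial \<Rightarrow> nat" where
  "mdeg u = (\<Sum>i\<in>Poly_Mapping.keys u. Poly_Mapping.lookup u i)"

definition T :: "nat \<Rightarrow> 'k::field polynomial ring" where
  "T n = \<lparr>carrier = {p. Poly_Mapping.keys p \<subseteq> monomials n},
          monoid.mult = (*), one = 1, zero = 0, add = (+)\<rparr>"

definition algebra_iso ::
    "nat \<Rightarrow> nat \<Rightarrow> ('k::field polynomial \<Rightarrow> 'k polynomial) set" where
  "algebra_iso m n = {\<Phi> \<in> ring_iso (T m) (T n). \<forall>c. \<Phi> (scalar c) = scalar c}"

definition monomial_ideal :: "nat \<Rightarrow> 'k::field polynomial set \<Rightarrow> bool" where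
  "monomial_ideal n I \<longleftrightarrow> (\<exists>S \<subseteq> monomials n. I = Idl\<^bsub>T n\<^esub> (mpoly_monom ` S))"

text \<open>
  The minimal monomial generators are the monomials of \<open>I\<close> that are minimal for divisibility. The
  lemmas \<open>genideal_min_gens\<close> and \<open>min_gens_subset\<close> below show that they form the least set of
  monomials generating \<open>I\<close>.
\<close>

definition min_gens :: "nat \<Rightarrow> 'k::field polynomial set \<Rightarrow> monomial set" where
  "min_gens n I = {u \<in> monomials n. mpoly_monom u \<in> I \<and>
     (\<forall>v \<in> monomials n. mpoly_monom v \<in> I \<and> mdvd v u \<longrightarrow> v = u)}"

definition ideal_deg :: "nat \<Rightarrow> 'k::field polynomial set \<Rightarrow> nat" where
  "ideal_deg n I = Max (mdeg ` min_gens n I)"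

text \<open>\<open>index_list u\<close> is the list \<open>i\<^sub>1 \<le> \<dots> \<le> i\<^sub>d\<close> of indices, with multiplicity, of the factors of \<open>u\<close>.\<close>

definition index_list :: "monomial \<Rightarrow> nat list" where
  "index_list u = concat (map (\<lambda>i. replicate (Poly_Mapping.lookup u i) i)
     (sorted_list_of_set (Poly_Mapping.keys u)))"

text \<open>List positions start at 0, so the factor at position \<open>k\<close> is shifted by \<open>k\<close>.\<close>

definition sigma :: "monomial \<Rightarrow> monomial" where
  "sigma u = (\<Sum>k<length (index_list u). Poly_Mapping.single (index_list u ! k + k) 1)"

definition polarization :: "nat \<Rightarrow> monomial \<Rightarrow> monomial" where
  "polarization n u =
     (\<Sum>j=1..n. \<Sum>k<Poly_Mapping.lookup u j. Poly_Mapping.single (k * n + j) 1)"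

definition smoothly_spreadable :: "nat \<Rightarrow> 'k::field polynomial set \<Rightarrow> bool" where
  "smoothly_spreadable n I \<longleftrightarrow> monomial_ideal n I \<and> I \<noteq> {0} \<and>
     (let d = ideal_deg n I in
      \<exists>\<tau> (\<Phi> :: 'k polynomial \<Rightarrow> 'k polynomial).
        \<tau> permutes {1..n * d} \<and> (\<forall>j\<in>{1..n * d}. [\<tau> j = j] (mod n)) \<and>
        \<Phi> \<in> algebra_iso (n * d) (n * d) \<and> (\<forall>j\<in>{1..n * d}. \<Phi> (var j) = var (\<tau> j)) \<and>
        (\<forall>u \<in> min_gens n I. \<Phi> (mpoly_monom ((sigma ^^ n) u)) = mpoly_monom (polarization n u)))"

lemma monomials_0: "0 \<in> monomials n"
  by (simp add: monomials_def)

lemma monomials_add: "u \<in> monomials n \<Longrightarrow> v \<in> monomials n \<Longrightarrow> u + v \<in> monomials n"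
  using Poly_Mapping.keys_add[of u v] by (auto simp: monomials_def)

lemma T_simps:
  "p \<in> carrier (T n) \<longleftrightarrow> Poly_Mapping.keys p \<subseteq> monomials n"
  "p \<otimes>\<^bsub>T n\<^esub> q = p * q" "p \<oplus>\<^bsub>T n\<^esub> q = p + q" "\<one>\<^bsub>T n\<^esub> = 1" "\<zero>\<^bsub>T n\<^esub> = 0"
  by (simp_all add: T_def)

lemma keys_mult_subset:
  fixes p q :: "'k::field polynomial"
  assumes "Poly_Mapping.keys p \<subseteq> monomials n" "Poly_Mapping.keys q \<subseteq> monomials n"
  shows "Poly_Mapping.keys (p * q) \<subseteq> monomials n"
proof
  fix w assume "w \<in> Poly_Mapping.keys (p * q)"
  then obtain u v where "w = u + v" "u \<in> Poly_Mapping.keys p" "v \<in> Poly_Mapping.keys q"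
    using keys_mult[of p q] by blast
  then show "w \<in> monomials n" using assms monomials_add by blast
qed

lemma keys_add_subset:
  fixes p q :: "'k::field polynomial"
  assumes "Poly_Mapping.keys p \<subseteq> A" "Poly_Mapping.keys q \<subseteq> A"
  shows "Poly_Mapping.keys (p + q) \<subseteq> A"
  using assms Poly_Mapping.keys_add[of p q] by blast

lemma cring_T: "cring (T n :: 'k::field polynomial ring)"
proof (rule cringI)
  show "abelian_group (T n :: 'k polynomial ring)"
  proof (rule abelian_groupI)
    fix p :: "'k polynomial" assume "p \<in> carrier (T n)"
    then show "\<exists>y\<in>carrier (T n). y \<oplus>\<^bsub>T n\<^esub> p = \<zero>\<^bsub>T n\<^esub>"
      by (intro bexI[of _ "-p"]) (simp_all add: T_simps Poly_Mapping.keys.rep_eq)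
  qed (simp_all add: T_simps add_ac keys_add_subset)
  show "comm_monoid (T n :: 'k polynomial ring)"
    by (rule comm_monoidI) (simp_all add: T_simps mult_ac monomials_0 keys_mult_subset)
qed (simp add: T_simps distrib_right)

lemma mpoly_monom_in_T: "mpoly_monom u \<in> carrier (T n) \<longleftrightarrow> u \<in> monomials n"
  by (simp add: T_simps mpoly_monom_def)

lemma mdvd_refl: "mdvd u u"
  by (simp add: mdvd_def)

lemma mdvd_trans: "mdvd u v \<Longrightarrow> mdvd v w \<Longrightarrow> mdvd u w"
  unfolding mdvd_def using le_trans by blast

lemma mdvd_antisym: "mdvd u v \<Longrightarrow> mdvd v u \<Longrightarrow> u = v"
  unfolding mdvd_def by (metis le_antisym poly_mapping_eqI)

lemma mdvd_add: "mdvd u (w + u)"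
  by (simp add: mdvd_def lookup_add)

lemma mdvdE:
  assumes "mdvd u v"
  obtains w where "v = w + u"
proof
  show "v = (v - u) + u"
    using assms by (intro poly_mapping_eqI) (simp add: lookup_add lookup_minus mdvd_def)
qed

lemma mdvd_keys: "mdvd u v \<Longrightarrow> Poly_Mapping.keys u \<subseteq> Poly_Mapping.keys v"
  unfolding mdvd_def by (metis in_keys_iff le_zero_eq subsetI)

lemma mdvd_monomials: "mdvd u v \<Longrightarrow> v \<in> monomials n \<Longrightarrow> u \<in> monomials n"
  using mdvd_keys by (fastforce simp: monomials_def)

lemma mdeg_superset:
  assumes "finite A" "Poly_Mapping.keys u \<subseteq> A"
  shows "mdeg u = (\<Sum>i\<in>A. Poly_Mapping.lookup u i)"
  unfolding mdeg_def using assms by (intro sum.mono_neutral_left) (auto simp: in_keys_iff)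

lemma mdeg_less:
  assumes "mdvd u v" "u \<noteq> v"
  shows "mdeg u < mdeg v"
proof -
  have sub: "Poly_Mapping.keys u \<subseteq> Poly_Mapping.keys v"
    using assms(1) by (rule mdvd_keys)
  obtain i where "Poly_Mapping.lookup u i \<noteq> Poly_Mapping.lookup v i"
    using assms(2) by (metis poly_mapping_eqI)
  with assms(1) have i: "Poly_Mapping.lookup u i < Poly_Mapping.lookup v i"
    by (simp add: mdvd_def order_less_le)
  have "mdeg u = (\<Sum>i\<in>Poly_Mapping.keys v. Poly_Mapping.lookup u i)"
    using sub by (intro mdeg_superset) auto
  also have "\<dots> < mdeg v"
    unfolding mdeg_def using assms(1) i
    by (intro sum_strict_mono_ex1) (use i in \<open>auto simp: mdvd_def in_keys_iff intro: bexI[of _ i]\<close>)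
  finally show ?thesis .
qed

lemma genideal_mon:
  fixes S :: "monomial set"
  assumes S: "S \<subseteq> monomials n"
  shows "Idl\<^bsub>T n\<^esub> (mpoly_monom ` S) = {p :: 'k::field polynomial. Poly_Mapping.keys p \<subseteq> monomials n \<and>
    (\<forall>u\<in>Poly_Mapping.keys p. \<exists>s\<in>S. mdvd s u)}" (is "_ = ?J")
proof -
  interpret cring "T n :: 'k polynomial ring" by (rule cring_T)
  have J: "ideal ?J (T n)"
  proof (rule idealI)
    show "ring (T n :: 'k polynomial ring)" by (rule ring_axioms)
    show "subgroup ?J (add_monoid (T n))"
    proof (rule add.subgroupI)
      show "?J \<subseteq> carrier (T n)" by (auto simp: T_simps)
      show "?J \<noteq> {}" by (auto intro!: exI[of _ 0])
    next
      fix p assume p: "p \<in> ?J"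
      then have "- p \<in> carrier (T n)" "p \<in> carrier (T n)"
        by (auto simp: T_simps Poly_Mapping.keys.rep_eq)
      then have "\<ominus>\<^bsub>T n\<^esub> p = - p"
        by (intro minus_equality) (auto simp: T_simps)
      then show "\<ominus>\<^bsub>T n\<^esub> p \<in> ?J" using p by (auto simp: Poly_Mapping.keys.rep_eq)
    next
      fix p q assume "p \<in> ?J" "q \<in> ?J"
      then show "p \<oplus>\<^bsub>T n\<^esub> q \<in> ?J"
        using Poly_Mapping.keys_add[of p q] by (auto simp: T_simps)
    qed
  next
    fix p x :: "'k polynomial" assume p: "p \<in> ?J" and x: "x \<in> carrier (T n)"
    have "\<exists>s\<in>S. mdvd s w" if w: "w \<in> Poly_Mapping.keys (x * p)" for w
    proof -
      obtain u v where "w = u + v" "v \<in> Poly_Mapping.keys p"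
        using w keys_mult[of x p] by blast
      then show ?thesis using p mdvd_add mdvd_trans by blast
    qed
    moreover have "Poly_Mapping.keys (x * p) \<subseteq> monomials n"
      using p x by (intro keys_mult_subset) (auto simp: T_simps)
    ultimately show "x \<otimes>\<^bsub>T n\<^esub> p \<in> ?J" "p \<otimes>\<^bsub>T n\<^esub> x \<in> ?J"
      by (auto simp: T_simps mult.commute)
  qed
  have "?J \<subseteq> I" if I: "ideal I (T n)" and SI: "mpoly_monom ` S \<subseteq> I" for I
  proof
    interpret I: ideal I "T n" by (rule I)
    fix p assume p: "p \<in> ?J"
    have single: "Poly_Mapping.single u (Poly_Mapping.lookup p u) \<in> I"
      if u: "u \<in> Poly_Mapping.keys p" for u
    proof -
      obtain s where s: "s \<in> S" "mdvd s u" using p u by blast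
      then obtain w where w: "u = w + s" using mdvdE by blast
      have "mdvd w u" unfolding w by (metis add.commute mdvd_add)
      then have wn: "w \<in> monomials n" using p u mdvd_monomials by blast
      have "Poly_Mapping.single w (Poly_Mapping.lookup p u) \<otimes>\<^bsub>T n\<^esub> mpoly_monom s \<in> I"
        using s SI wn by (intro I.I_l_closed) (auto simp: T_simps)
      then show ?thesis by (simp add: T_simps mpoly_monom_def mult_single w)
    qed
    have "(\<Sum>u\<in>A. Poly_Mapping.single u (Poly_Mapping.lookup p u)) \<in> I"
      if "finite A" "A \<subseteq> Poly_Mapping.keys p" for A
      using that
    proof (induction A rule: finite_induct)
      case empty
      then show ?case using I.zero_closed by (simp add: T_simps)
    next
      case (insert u A)
      then show ?case
        using I.a_closed[OF single insert.IH, of u] by (simp add: T_simps)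
    qed
    then have "(\<Sum>u\<in>Poly_Mapping.keys p. Poly_Mapping.single u (Poly_Mapping.lookup p u)) \<in> I"
      by simp
    moreover have "(\<Sum>u\<in>Poly_Mapping.keys p. Poly_Mapping.single u (Poly_Mapping.lookup p u)) = p"
      by (rule poly_mapping_eqI)
        (simp add: lookup_sum lookup_single when_def in_keys_iff sum.delta)
    ultimately show "p \<in> I" by simp
  qed
  moreover have "mpoly_monom ` S \<subseteq> ?J"
    using S by (auto simp: mpoly_monom_def intro: mdvd_refl)
  ultimately show ?thesis
    unfolding genideal_def using J by blast
qed

lemma mon_in_genideal:
  assumes "S \<subseteq> monomials n"
  shows "(mpoly_monom v :: 'k::field polynomial) \<in> Idl\<^bsub>T n\<^esub> (mpoly_monom ` S) \<longleftrightarrow>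
    v \<in> monomials n \<and> (\<exists>s\<in>S. mdvd s v)"
  by (simp add: genideal_mon[OF assms]) (simp add: mpoly_monom_def)

lemma min_gens_dvd:
  fixes I :: "'k::field polynomial set"
  assumes "u \<in> monomials n" "mpoly_monom u \<in> I"
  shows "\<exists>v\<in>min_gens n I. mdvd v u"
  using assms
proof (induction "mdeg u" arbitrary: u rule: less_induct)
  case less
  show ?case
  proof (cases "u \<in> min_gens n I")
    case True
    then show ?thesis using mdvd_refl by blast
  next
    case False
    then obtain v where v: "v \<in> monomials n" "mpoly_monom v \<in> I" "mdvd v u" "v \<noteq> u"
      using less.prems by (auto simp: min_gens_def)
    obtain w where "w \<in> min_gens n I" "mdvd w v"
      using less.hyps[OF mdeg_less[OF v(3,4)] v(1,2)] by auto
    then show ?thesis using mdvd_trans[OF _ v(3)] by auto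
  qed
qed

lemma genideal_min_gens:
  fixes I :: "'k::field polynomial set"
  assumes "monomial_ideal n I"
  shows "Idl\<^bsub>T n\<^esub> (mpoly_monom ` min_gens n I) = I"
proof -
  obtain S where S: "S \<subseteq> monomials n" "I = Idl\<^bsub>T n\<^esub> (mpoly_monom ` S)"
    using assms unfolding monomial_ideal_def by blast
  have G: "min_gens n I \<subseteq> monomials n" by (auto simp: min_gens_def)
  have "\<exists>g\<in>min_gens n I. mdvd g s" if "s \<in> S" for s
  proof (rule min_gens_dvd)
    show "s \<in> monomials n" using that S(1) by blast
    then show "mpoly_monom s \<in> I"
      using that mdvd_refl by (auto simp: S(2) mon_in_genideal[OF S(1)])
  qed
  moreover have "\<exists>s\<in>S. mdvd s g" if "g \<in> min_gens n I" for g
    using that by (simp add: min_gens_def S(2) mon_in_genideal[OF S(1)])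
  ultimately have "(\<exists>g\<in>min_gens n I. mdvd g u) \<longleftrightarrow> (\<exists>s\<in>S. mdvd s u)" for u
    by (meson mdvd_trans)
  then show ?thesis
    unfolding genideal_mon[OF G] using S(2) genideal_mon[OF S(1), where ?'k = 'k] by simp
qed

lemma min_gens_subset:
  fixes I :: "'k::field polynomial set"
  assumes S: "S \<subseteq> monomials n" and I: "I = Idl\<^bsub>T n\<^esub> (mpoly_monom ` S)"
  shows "min_gens n I \<subseteq> S"
proof
  fix u assume u: "u \<in> min_gens n I"
  then obtain s where s: "s \<in> S" "mdvd s u"
    by (auto simp: min_gens_def I mon_in_genideal[OF S])
  then have "s \<in> monomials n" "(mpoly_monom s :: 'k polynomial) \<in> I"
    using S mdvd_refl by (auto simp: I mon_in_genideal[OF S])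
  then have "s = u" using u s(2) by (simp add: min_gens_def)
  then show "u \<in> S" using s(1) by simp
qed

end

theory Submission
  imports Defs
begin

text \<open>
  Both \<open>\<sigma>\<^sup>n(u)\<close> and \<open>u\<^sup>p\<close> are squarefree monomials, so each is a finite set of indices, and an algebra
  automorphism that permutes the variables by \<open>\<tau>\<close> carries one to the other exactly when \<open>\<tau>\<close> maps the
  one set onto the other. Since every permutation of the variables extends to such an automorphism,
  smooth spreadability asks only for a permutation \<open>\<tau>\<close> of the indices that preserves residues modulo
  \<open>n\<close> and matches these sets for all minimal generators at once (\<open>smoothly_spreadable_iff\<close>).

  For \<open>n = 2\<close> and \<open>u = x\<^sub>1\<^sup>a x\<^sub>2\<^sup>b\<close> the odd indices of the two sets agree: they are the first \<open>a\<close> odd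
  numbers. The even indices are \<open>2k + 2\<close> with \<open>k\<close> in \<open>[a, a + b)\<close> for \<open>\<sigma>\<^sup>2(u)\<close> and with \<open>k\<close> in \<open>[0, b)\<close>
  for \<open>u\<^sup>p\<close>. The monomials of the ideal below form an antichain, hence all of them are minimal
  generators, and the question is whether one permutation \<open>\<pi>\<close> of \<open>{0, \<dots>, d - 1}\<close> sends every
  interval \<open>[a\<^sub>i, a\<^sub>i + b\<^sub>i)\<close> onto \<open>[0, b\<^sub>i)\<close>.

  If the degrees \<open>a\<^sub>i + b\<^sub>i\<close> do not decrease, then, as the \<open>a\<^sub>i\<close> decrease, these intervals form an
  increasing chain, and any finite chain of sets can be numbered so that its members become
  initial segments (\<open>chain_to_initial_segments\<close>). Conversely, the segments \<open>[0, b\<^sub>i)\<close> increase with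
  \<open>i\<close>, so by injectivity of \<open>\<tau>\<close> the intervals do too; whenever the \<open>i\<close>-th interval is nonempty, that
  is \<open>b\<^sub>i > 0\<close>, comparing right endpoints gives \<open>a\<^sub>i + b\<^sub>i \<le> a\<^bsub>i+1\<^esub> + b\<^bsub>i+1\<^esub>\<close>. As the \<open>b\<^sub>i\<close> increase strictly,
  only \<open>b\<^sub>1\<close> can vanish.
\<close>

section \<open>Permuting the variables of a polynomial ring\<close>

lemma poly_mapping_induct_single [case_names zero single add]:
  fixes p :: "'a \<Rightarrow>\<^sub>0 'b::comm_monoid_add"
  assumes zero: "P 0" and single: "\<And>u c. P (Poly_Mapping.single u c)"
    and add: "\<And>p q. P p \<Longrightarrow> P q \<Longrightarrow> P (p + q)"
  shows "P p"
proof (induction p rule: Poly_Mapping.update_induct)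
  case const
  show ?case by (rule zero)
next
  case (update f a b)
  have "Poly_Mapping.update a b f = Poly_Mapping.single a b + f"
    using update.hyps by (intro poly_mapping_eqI)
      (auto simp: lookup_add lookup_single lookup_update in_keys_iff when_def)
  then show ?case using add[OF single update.IH] by simp
qed

text \<open>
  Relabelling the exponents of a monoid algebra along an additive bijection is a ring homomorphism;
  both sides are biadditive, so single terms suffice.
\<close>

lemma map_key_mult:
  fixes p q :: "'a::monoid_add \<Rightarrow>\<^sub>0 'b::semiring_0"
  assumes g: "bij g" and add: "\<And>u v. g (u + v) = g u + g v"
  shows "Poly_Mapping.map_key g (p * q) = Poly_Mapping.map_key g p * Poly_Mapping.map_key g q"
proof -
  note inj = bij_is_inj[OF g]
  have 1: "Poly_Mapping.map_key g (Poly_Mapping.single u c * Poly_Mapping.single v e) =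
      Poly_Mapping.map_key g (Poly_Mapping.single u c) *
      Poly_Mapping.map_key g (Poly_Mapping.single v e)" for u v c e
  proof -
    obtain u' v' where uv: "u = g u'" "v = g v'"
      using bij_is_surj[OF g] by (meson surjD)
    show ?thesis
      unfolding uv mult_single add[symmetric] by (simp add: map_key_single[OF inj] mult_single)
  qed
  have 2: "Poly_Mapping.map_key g (Poly_Mapping.single u c * q) =
      Poly_Mapping.map_key g (Poly_Mapping.single u c) * Poly_Mapping.map_key g q" for u c
    by (induction q rule: poly_mapping_induct_single)
      (simp_all add: 1 map_key_zero[OF inj] map_key_plus[OF inj] distrib_left)
  show ?thesis
    by (induction p rule: poly_mapping_induct_single)
      (simp_all add: 2 map_key_zero[OF inj] map_key_plus[OF inj] distrib_right)
qed

text \<open>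
  Precomposing exponent vectors with \<open>\<tau>\<close> moves the exponent of \<open>x\<^bsub>\<tau> j\<^esub>\<close> to \<open>x\<^sub>j\<close>; precomposing
  coefficient functions with that operation therefore reverses the direction once more and sends
  \<open>x\<^sub>j\<close> to \<open>x\<^bsub>\<tau> j\<^esub>\<close>.
\<close>

lemma permutation_algebra_iso:
  assumes \<tau>: "\<tau> permutes {1..N}"
  shows "\<exists>\<Phi> \<in> algebra_iso N N. \<forall>j. \<Phi> (var j) = (var (\<tau> j) :: 'k::field polynomial)"
proof -
  define g :: "(nat \<Rightarrow> nat) \<Rightarrow> monomial \<Rightarrow> monomial" where "g = Poly_Mapping.map_key"
  define F :: "(nat \<Rightarrow> nat) \<Rightarrow> 'k polynomial \<Rightarrow> 'k polynomial"
    where "F = (\<lambda>\<rho>. Poly_Mapping.map_key (g \<rho>))"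
  have inj: "inj \<rho>" if "\<rho> permutes {1..N}" for \<rho> using that by (rule permutes_inj)
  have g_inv: "g \<rho> (g \<rho>' u) = u" if "\<rho> permutes {1..N}" "\<rho>' permutes {1..N}" "\<rho>' \<circ> \<rho> = id" for \<rho> \<rho>' u
    using that by (simp add: g_def map_key_compose inj map_key_id id_def)
  have inv: "inv_into UNIV \<rho> permutes {1..N}" "inv_into UNIV \<rho> \<circ> \<rho> = id" "\<rho> \<circ> inv_into UNIV \<rho> = id"
    if "\<rho> permutes {1..N}" for \<rho>
    using that by (simp_all add: permutes_inv permutes_inv_o)
  have bij: "bij (g \<rho>)" if "\<rho> permutes {1..N}" for \<rho>
    by (rule o_bij[of "g (inv_into UNIV \<rho>)"])
      (use that inv[OF that] g_inv in \<open>auto simp: fun_eq_iff\<close>)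
  have g_inj: "inj (g \<rho>)" if "\<rho> permutes {1..N}" for \<rho>
    using bij[OF that] by (rule bij_is_inj)
  have F_inv: "F \<rho> (F \<rho>' p) = p" if "\<rho> permutes {1..N}" "\<rho>' permutes {1..N}" "\<rho> \<circ> \<rho>' = id" for \<rho> \<rho>' p
  proof -
    have "g \<rho>' \<circ> g \<rho> = (\<lambda>u. u)" using g_inv[OF that(2,1,3)] by (auto simp: fun_eq_iff)
    then show ?thesis using that(1,2) by (simp add: F_def map_key_compose g_inj map_key_id)
  qed
  have F_carrier: "F \<rho> p \<in> carrier (T N)" if \<rho>: "\<rho> permutes {1..N}" and p: "p \<in> carrier (T N)" for \<rho> p
  proof -
    have "u \<in> monomials N" if u: "u \<in> Poly_Mapping.keys (F \<rho> p)" for u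
    proof -
      have "g \<rho> u \<in> monomials N"
        using u p by (auto simp: F_def keys_map_key[OF g_inj[OF \<rho>]] T_simps)
      then have "\<rho> -` Poly_Mapping.keys u \<subseteq> {1..N}"
        by (simp add: monomials_def g_def keys_map_key[OF inj[OF \<rho>]])
      then show ?thesis
        using permutes_surj[OF \<rho>] permutes_in_image[OF \<rho>]
        by (auto simp: monomials_def subset_iff) (metis surjD)+
    qed
    then show ?thesis by (auto simp: T_simps)
  qed
  have F_single: "F \<rho> (Poly_Mapping.single (g \<rho> u) c) = Poly_Mapping.single u c"
    if "\<rho> permutes {1..N}" for \<rho> u c
    using g_inj[OF that] by (simp add: F_def)
  have g0: "g \<tau> 0 = 0" using inj[OF \<tau>] by (simp add: g_def)
  have F_scalar: "F \<tau> (scalar c) = scalar c" for c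
    using F_single[OF \<tau>, of 0 c] by (simp add: scalar_def g0)
  have "F \<tau> \<in> ring_iso (T N) (T N)"
  proof (rule ring_iso_memI)
    show "F \<tau> (x \<otimes>\<^bsub>T N\<^esub> y) = F \<tau> x \<otimes>\<^bsub>T N\<^esub> F \<tau> y" for x y
      unfolding T_simps F_def
      by (rule map_key_mult[OF bij[OF \<tau>]]) (simp add: g_def map_key_plus inj[OF \<tau>])
    show "F \<tau> (x \<oplus>\<^bsub>T N\<^esub> y) = F \<tau> x \<oplus>\<^bsub>T N\<^esub> F \<tau> y" for x y
      unfolding T_simps F_def by (rule map_key_plus[OF g_inj[OF \<tau>]])
    show "F \<tau> \<one>\<^bsub>T N\<^esub> = \<one>\<^bsub>T N\<^esub>"
      using F_scalar[of 1] by (simp add: T_simps scalar_def)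
    show "bij_betw (F \<tau>) (carrier (T N)) (carrier (T N))"
      by (rule bij_betw_byWitness[where f' = "F (inv_into UNIV \<tau>)"])
        (use \<tau> inv[OF \<tau>] F_inv F_carrier in auto)
  qed (use F_carrier \<tau> in auto)
  moreover have "F \<tau> (var j) = var (\<tau> j)" for j
    using F_single[OF \<tau>, of "Poly_Mapping.single (\<tau> j) 1" 1] inj[OF \<tau>]
    by (simp add: var_def mpoly_monom_def g_def)
  ultimately show ?thesis using F_scalar by (auto simp: algebra_iso_def)
qed

section \<open>Squarefree monomials\<close>

definition squarefree_monomial :: "nat set \<Rightarrow> monomial" where
  "squarefree_monomial A = (\<Sum>i\<in>A. Poly_Mapping.single i 1)"

lemma squarefree_monomial_inject:
  assumes "finite A" "finite B"
  shows "squarefree_monomial A = squarefree_monomial B \<longleftrightarrow> A = B"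
proof -
  have "A = {i. Poly_Mapping.lookup (squarefree_monomial A) i = 1}" if "finite A" for A
    using that by (auto simp: squarefree_monomial_def lookup_sum lookup_single when_def sum.delta)
  then show ?thesis using assms by metis
qed

lemma squarefree_monomial_in_monomials:
  "A \<subseteq> {1..N} \<Longrightarrow> squarefree_monomial A \<in> monomials N"
proof (induction A rule: infinite_finite_induct)
  case (insert i A)
  have "Poly_Mapping.single i (1::nat) \<in> monomials N"
    using insert.prems by (simp add: monomials_def)
  then show ?case using insert by (simp add: squarefree_monomial_def monomials_add)
qed (simp_all add: squarefree_monomial_def monomials_0)

lemma mpoly_monom_add: "mpoly_monom (u + v) = mpoly_monom u * mpoly_monom v"
  by (simp add: mpoly_monom_def mult_single)

lemma mpoly_monom_0: "mpoly_monom 0 = 1"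
  by (simp add: mpoly_monom_def)

lemma mpoly_monom_inject:
  "(mpoly_monom u :: 'k::field polynomial) = mpoly_monom v \<longleftrightarrow> u = v"
proof
  assume "(mpoly_monom u :: 'k polynomial) = mpoly_monom v"
  then have "Poly_Mapping.keys (mpoly_monom u :: 'k polynomial) = Poly_Mapping.keys (mpoly_monom v :: 'k polynomial)"
    by simp
  then show "u = v" by (simp add: mpoly_monom_def)
qed simp

text \<open>
  Multiplicativity moves the map past one variable at a time. It is known only on the polynomials
  in the variables up to \<open>N\<close>, so all partial products have to stay in that ring.
\<close>

lemma algebra_iso_squarefree:
  fixes \<Phi> :: "'k::field polynomial \<Rightarrow> 'k polynomial"
  assumes \<Phi>: "\<Phi> \<in> algebra_iso N N" and \<tau>: "\<tau> permutes {1..N}"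
    and var: "\<forall>j\<in>{1..N}. \<Phi> (var j) = var (\<tau> j)" and A: "A \<subseteq> {1..N}"
  shows "\<Phi> (mpoly_monom (squarefree_monomial A)) = mpoly_monom (squarefree_monomial (\<tau> ` A))"
proof -
  have iso: "\<Phi> \<in> ring_iso (T N) (T N)" using \<Phi> by (simp add: algebra_iso_def)
  have "finite A" using A finite_subset by blast
  then show ?thesis using A
  proof (induction A rule: finite_induct)
    case empty
    show ?case using ring_iso_memE(4)[OF iso]
      by (simp add: squarefree_monomial_def mpoly_monom_0 T_simps)
  next
    case (insert i A)
    have ins: "mpoly_monom (squarefree_monomial (insert j B)) =
        (var j * mpoly_monom (squarefree_monomial B) :: 'k polynomial)" if "finite B" "j \<notin> B" for j B
      using that by (simp add: squarefree_monomial_def mpoly_monom_add var_def)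
    have "(var i :: 'k polynomial) \<in> carrier (T N)"
      using insert.prems by (simp add: var_def mpoly_monom_in_T monomials_def)
    moreover have "(mpoly_monom (squarefree_monomial A) :: 'k polynomial) \<in> carrier (T N)"
      using insert.prems by (simp add: mpoly_monom_in_T squarefree_monomial_in_monomials)
    ultimately have "\<Phi> (mpoly_monom (squarefree_monomial (insert i A))) =
        \<Phi> (var i) * \<Phi> (mpoly_monom (squarefree_monomial A))"
      using ring_iso_memE(2)[OF iso] insert.hyps by (simp add: ins T_simps)
    also have "\<dots> = var (\<tau> i) * mpoly_monom (squarefree_monomial (\<tau> ` A))"
      using insert var by simp
    also have "\<dots> = mpoly_monom (squarefree_monomial (\<tau> ` insert i A))"
      using insert.hyps permutes_inj[OF \<tau>] by (simp add: ins inj_image_mem_iff)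
    finally show ?case .
  qed
qed

section \<open>Index lists and the iterates of the spreading operator\<close>

definition list_monomial :: "nat list \<Rightarrow> monomial" where
  "list_monomial xs = (\<Sum>i\<leftarrow>xs. Poly_Mapping.single i 1)"

lemma lookup_list_monomial: "Poly_Mapping.lookup (list_monomial xs) j = count (mset xs) j"
  by (induction xs) (simp_all add: list_monomial_def lookup_add lookup_single)

lemma count_mset_index_list: "count (mset (index_list u)) j = Poly_Mapping.lookup u j"
proof -
  have "count (mset (concat (map (\<lambda>i. replicate (f i) i) xs))) j = (if j \<in> set xs then f j else 0)"
    if "distinct xs" for f :: "nat \<Rightarrow> nat" and xs
    using that by (induction xs) auto
  then show ?thesis by (simp add: index_list_def in_keys_iff)
qed

lemma sorted_index_list: "sorted (index_list u)"
proof -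
  have "sorted (concat (map (\<lambda>i. replicate (f i) i) xs))" if "sorted xs" for f :: "nat \<Rightarrow> nat" and xs
    using that by (induction xs) (auto simp: sorted_append)
  then show ?thesis by (simp add: index_list_def)
qed

lemma list_monomial_index_list: "list_monomial (index_list u) = u"
  by (rule poly_mapping_eqI) (simp add: lookup_list_monomial count_mset_index_list)

text \<open>
  A sorted list is determined by the multiset of its entries, which is the exponent vector. Hence
  the index list of a monomial can be computed by exhibiting any sorted list of factors.
\<close>

lemma index_list_list_monomial:
  assumes "sorted xs"
  shows "index_list (list_monomial xs) = xs"
proof -
  have "mset (index_list (list_monomial xs)) = mset xs"
    by (rule multiset_eqI) (simp add: count_mset_index_list lookup_list_monomial)
  then show ?thesis using assms sorted_index_list by (metis properties_for_sort)
qed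

lemma mdeg_eq_length_index_list: "mdeg u = length (index_list u)"
proof -
  have "Poly_Mapping.keys u = set_mset (mset (index_list u))"
    by (metis count_mset_index_list count_eq_zero_iff in_keys_iff subset_antisym subsetI)
  then have "mdeg u = size (mset (index_list u))"
    unfolding mdeg_def size_multiset_overloaded_eq by (simp add: count_mset_index_list)
  then show ?thesis by simp
qed

text \<open>
  Spreading keeps the factors in order, because later positions are shifted further, so the next
  application of \<open>\<sigma>\<close> sees the same positions and the shifts simply add up.
\<close>

lemma index_list_sigma_pow:
  "index_list ((sigma ^^ t) u) =
    map (\<lambda>k. index_list u ! k + t * k) [0..<length (index_list u)]"
proof (induction t)
  case 0
  show ?case by (simp add: map_nth)
next
  case (Suc t)
  let ?L = "index_list u" and ?v = "(sigma ^^ t) u"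
  let ?xs = "map (\<lambda>k. ?L ! k + Suc t * k) [0..<length ?L]"
  have "sigma ?v = (\<Sum>k<length ?L. Poly_Mapping.single (?L ! k + Suc t * k) 1)"
    unfolding sigma_def Suc by (intro sum.cong) (auto simp: algebra_simps)
  also have "\<dots> = list_monomial ?xs"
    by (simp add: list_monomial_def o_def interv_sum_list_conv_sum_set_nat atLeast0LessThan)
  finally have "sigma ?v = list_monomial ?xs" .
  moreover have "sorted ?xs"
    unfolding sorted_iff_nth_mono
    by (auto intro!: add_mono mult_mono sorted_nth_mono[OF sorted_index_list])
  ultimately show ?case by (simp add: index_list_list_monomial)
qed

section \<open>Smooth spreadability as a statement about index sets\<close>

definition spread_support :: "nat \<Rightarrow> monomial \<Rightarrow> nat set" where
  "spread_support t u = (\<lambda>k. index_list u ! k + t * k) ` {..<length (index_list u)}"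

definition polar_support :: "nat \<Rightarrow> monomial \<Rightarrow> nat set" where
  "polar_support n u = (\<Union>j\<in>{1..n}. (\<lambda>k. k * n + j) ` {..<Poly_Mapping.lookup u j})"

text \<open>After at least one application of \<open>\<sigma>\<close> equal neighbouring factors have been pulled apart.\<close>

lemma sigma_pow_squarefree:
  assumes "t > 0"
  shows "(sigma ^^ t) u = squarefree_monomial (spread_support t u)"
proof -
  have "strict_mono_on {..<length (index_list u)} (\<lambda>k. index_list u ! k + t * k)"
    using assms by (intro strict_mono_onI)
      (simp add: add_le_less_mono sorted_nth_mono[OF sorted_index_list])
  then have inj: "inj_on (\<lambda>k. index_list u ! k + t * k) {..<length (index_list u)}"
    by (rule strict_mono_on_imp_inj_on)
  have "(sigma ^^ t) u = list_monomial (map (\<lambda>k. index_list u ! k + t * k) [0..<length (index_list u)])"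
    by (metis index_list_sigma_pow list_monomial_index_list)
  also have "\<dots> = squarefree_monomial (spread_support t u)"
    unfolding squarefree_monomial_def spread_support_def sum.reindex[OF inj]
    by (simp add: list_monomial_def o_def interv_sum_list_conv_sum_set_nat atLeast0LessThan)
  finally show ?thesis .
qed

text \<open>
  The residue of \<open>k n + j\<close> modulo \<open>n\<close> determines \<open>j \<in> {1..n}\<close>, and then the quotient determines \<open>k\<close>.
\<close>

lemma polarization_squarefree: "polarization n u = squarefree_monomial (polar_support n u)"
proof -
  have eq: "j = j' \<and> k = k'" if "j \<in> {1..n}" "j' \<in> {1..n}" "k * n + j = k' * n + j'" for j j' k k' :: nat
  proof -
    \<comment> \<open>The shift by 1 is needed since residues are represented by \<open>1, \<dots>, n\<close> and not by \<open>0, \<dots>, n - 1\<close>.\<close>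
    have div: "(l * n + (i - 1)) div n = l" if "i \<in> {1..n}" for l i
    proof -
      have "i - 1 < n" "n \<noteq> 0" using that by auto
      then show ?thesis by simp
    qed
    have "k * n + (j - 1) = k' * n + (j' - 1)" using that by simp
    then have "k = k'" using div[OF that(1), of k] div[OF that(2), of k'] by simp
    then show ?thesis using that by simp
  qed
  have "squarefree_monomial (polar_support n u) =
      (\<Sum>j=1..n. \<Sum>i\<in>(\<lambda>k. k * n + j) ` {..<Poly_Mapping.lookup u j}. Poly_Mapping.single i 1)"
    unfolding squarefree_monomial_def polar_support_def
  proof (rule sum.UNION_disjoint)
    show "\<forall>j\<in>{1..n}. \<forall>j'\<in>{1..n}. j \<noteq> j' \<longrightarrow>
        (\<lambda>k. k * n + j) ` {..<Poly_Mapping.lookup u j} \<inter>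
        (\<lambda>k. k * n + j') ` {..<Poly_Mapping.lookup u j'} = {}"
      using eq by blast
  qed simp_all
  also have "\<dots> = polarization n u"
    unfolding polarization_def
  proof (rule sum.cong)
    fix j assume "j \<in> {1..n}"
    then have "inj_on (\<lambda>k. k * n + j) {..<Poly_Mapping.lookup u j}" by (auto simp: inj_on_def)
    then show "(\<Sum>i\<in>(\<lambda>k. k * n + j) ` {..<Poly_Mapping.lookup u j}. Poly_Mapping.single i 1) =
        (\<Sum>k<Poly_Mapping.lookup u j. Poly_Mapping.single (k * n + j) (1::nat))"
      by (simp add: sum.reindex)
  qed simp
  finally show ?thesis by simp
qed

text \<open>
  The factor at the last position, at most \<open>d - 1\<close>, has index at most \<open>n\<close> and is shifted by at most
  \<open>n (d - 1)\<close>. So the \<open>n d\<close> variables of the definition contain all the spread generators.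
\<close>

lemma spread_support_subset:
  assumes "u \<in> monomials n" "mdeg u \<le> d"
  shows "spread_support n u \<subseteq> {1..n * d}"
proof
  fix x assume "x \<in> spread_support n u"
  then obtain k where k: "k < length (index_list u)" "x = index_list u ! k + n * k"
    by (auto simp: spread_support_def)
  have "index_list u ! k \<in># mset (index_list u)" using k(1) by simp
  then have "index_list u ! k \<in> Poly_Mapping.keys u"
    by (metis count_mset_index_list count_eq_zero_iff in_keys_iff)
  then have "index_list u ! k \<in> {1..n}" using assms(1) by (auto simp: monomials_def)
  moreover have "n * Suc k \<le> n * d"
    using k(1) assms(2) by (intro mult_le_mono) (simp_all add: mdeg_eq_length_index_list)
  ultimately show "x \<in> {1..n * d}" using k(2) by auto
qed

text \<open>
  On squarefree monomials an algebra map that permutes the variables acts through their index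
  sets, which removes the ring from the definition. Finiteness of the set of generators makes the
  maximal degree \<open>d\<close> meaningful.
\<close>

lemma smoothly_spreadable_iff:
  fixes I :: "'k::field polynomial set"
  assumes n: "n > 0" and fin: "finite (min_gens n I)"
  defines "d \<equiv> ideal_deg n I"
  shows "smoothly_spreadable n I \<longleftrightarrow> monomial_ideal n I \<and> I \<noteq> {0} \<and>
    (\<exists>\<tau>. \<tau> permutes {1..n * d} \<and> (\<forall>j\<in>{1..n * d}. [\<tau> j = j] (mod n)) \<and>
      (\<forall>u\<in>min_gens n I. \<tau> ` spread_support n u = polar_support n u))"
proof -
  have sub: "spread_support n u \<subseteq> {1..n * d}" if "u \<in> min_gens n I" for u
    using that fin by (intro spread_support_subset) (auto simp: min_gens_def d_def ideal_deg_def)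
  have *: "\<Phi> (mpoly_monom ((sigma ^^ n) u)) = mpoly_monom (polarization n u) \<longleftrightarrow>
      \<tau> ` spread_support n u = polar_support n u"
    if "\<tau> permutes {1..n * d}" "\<Phi> \<in> algebra_iso (n * d) (n * d)"
      "\<forall>j\<in>{1..n * d}. \<Phi> (var j) = var (\<tau> j)" "u \<in> min_gens n I"
    for \<tau> and \<Phi> :: "'k polynomial \<Rightarrow> 'k polynomial" and u
    unfolding sigma_pow_squarefree[OF n] polarization_squarefree
      algebra_iso_squarefree[OF that(2,1,3) sub[OF that(4)]] mpoly_monom_inject
    by (rule squarefree_monomial_inject) (simp_all add: spread_support_def polar_support_def)
  have "(\<exists>\<Phi> :: 'k polynomial \<Rightarrow> 'k polynomial.
        \<tau> permutes {1..n * d} \<and> (\<forall>j\<in>{1..n * d}. [\<tau> j = j] (mod n)) \<and>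
        \<Phi> \<in> algebra_iso (n * d) (n * d) \<and> (\<forall>j\<in>{1..n * d}. \<Phi> (var j) = var (\<tau> j)) \<and>
        (\<forall>u\<in>min_gens n I. \<Phi> (mpoly_monom ((sigma ^^ n) u)) = mpoly_monom (polarization n u)))
    \<longleftrightarrow> \<tau> permutes {1..n * d} \<and> (\<forall>j\<in>{1..n * d}. [\<tau> j = j] (mod n)) \<and>
        (\<forall>u\<in>min_gens n I. \<tau> ` spread_support n u = polar_support n u)"
    (is "?L \<longleftrightarrow> ?R") for \<tau>
  proof
    assume ?L
    then obtain \<Phi> :: "'k polynomial \<Rightarrow> 'k polynomial" where \<Phi>:
      "\<tau> permutes {1..n * d}" "\<forall>j\<in>{1..n * d}. [\<tau> j = j] (mod n)"
      "\<Phi> \<in> algebra_iso (n * d) (n * d)" "\<forall>j\<in>{1..n * d}. \<Phi> (var j) = var (\<tau> j)"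
      "\<forall>u\<in>min_gens n I. \<Phi> (mpoly_monom ((sigma ^^ n) u)) = mpoly_monom (polarization n u)"
      by blast
    show ?R using \<Phi>(1,2,5) *[OF \<Phi>(1,3,4)] by simp
  next
    assume R: ?R
    then obtain \<Phi> :: "'k polynomial \<Rightarrow> 'k polynomial"
      where \<Phi>: "\<Phi> \<in> algebra_iso (n * d) (n * d)" "\<forall>j. \<Phi> (var j) = var (\<tau> j)"
      using permutation_algebra_iso[of \<tau> "n * d", where ?'k = 'k] by blast
    show ?L using R \<Phi> *[of \<tau> \<Phi>] by (intro exI[of _ \<Phi>]) simp
  qed
  then show ?thesis
    unfolding smoothly_spreadable_def Let_def d_def[symmetric] by simp
qed

section \<open>Minimal generators of an antichain\<close>

lemma min_gens_antichain:
  fixes I :: "'k::field polynomial set"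
  assumes S: "S \<subseteq> monomials n" and I: "I = Idl\<^bsub>T n\<^esub> (mpoly_monom ` S)"
    and anti: "\<And>u v. u \<in> S \<Longrightarrow> v \<in> S \<Longrightarrow> mdvd u v \<Longrightarrow> u = v"
  shows "min_gens n I = S"
proof
  show "min_gens n I \<subseteq> S" using S I by (rule min_gens_subset)
  show "S \<subseteq> min_gens n I"
  proof
    fix u assume "u \<in> S"
    then show "u \<in> min_gens n I"
      using S anti by (auto simp: min_gens_def I mon_in_genideal[OF S] intro: mdvd_refl)
        (metis mdvd_antisym mdvd_trans)
  qed
qed

section \<open>Monomials in two variables\<close>

definition two_var :: "nat \<Rightarrow> nat \<Rightarrow> monomial" where
  "two_var a b = Poly_Mapping.single 1 a + Poly_Mapping.single 2 b"

lemma lookup_two_var: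
  "Poly_Mapping.lookup (two_var a b) i = (if i = 1 then a else if i = 2 then b else 0)"
  by (simp add: two_var_def lookup_add lookup_single when_def)

lemma two_var_in_monomials: "two_var a b \<in> monomials 2"
  by (auto simp: monomials_def in_keys_iff lookup_two_var split: if_splits)

lemma mdvd_two_var: "mdvd (two_var a b) (two_var a' b') \<longleftrightarrow> a \<le> a' \<and> b \<le> b'"
proof
  assume "mdvd (two_var a b) (two_var a' b')"
  then have "Poly_Mapping.lookup (two_var a b) i \<le> Poly_Mapping.lookup (two_var a' b') i" for i
    by (simp add: mdvd_def)
  from this[of 1] this[of 2] show "a \<le> a' \<and> b \<le> b'" by (simp add: lookup_two_var)
qed (simp add: mdvd_def lookup_two_var)

lemma mpoly_monom_two_var:
  "(mpoly_monom (two_var a b) :: 'k::field polynomial) = var 1 ^ a * var 2 ^ b"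
proof -
  have "(mpoly_monom (Poly_Mapping.single i e) :: 'k polynomial) = var i ^ e" for i e
  proof (induction e)
    case (Suc e)
    have "Poly_Mapping.single i (Suc e) = Poly_Mapping.single i 1 + Poly_Mapping.single i e"
      by (simp flip: single_add)
    then show ?case using Suc by (simp add: mpoly_monom_add var_def)
  qed (simp add: mpoly_monom_0)
  then show ?thesis by (simp add: two_var_def mpoly_monom_add)
qed

lemma index_list_two_var: "index_list (two_var a b) = replicate a 1 @ replicate b 2"
proof -
  have "two_var a b = list_monomial (replicate a 1 @ replicate b 2)"
    by (rule poly_mapping_eqI) (simp add: lookup_two_var lookup_list_monomial)
  then show ?thesis by (simp add: index_list_list_monomial sorted_append)
qed

lemma mdeg_two_var: "mdeg (two_var a b) = a + b"
  by (simp add: mdeg_eq_length_index_list index_list_two_var)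

lemma spread_support_two_var:
  "spread_support 2 (two_var a b) = (\<lambda>k. 2 * k + 1) ` {..<a} \<union> (\<lambda>k. 2 * k + 2) ` {a..<a + b}"
proof -
  have "{..<a + b} = {..<a} \<union> {a..<a + b}" by auto
  then have "spread_support 2 (two_var a b) =
      (\<lambda>k. (replicate a 1 @ replicate b 2) ! k + 2 * k) ` {..<a} \<union>
      (\<lambda>k. (replicate a 1 @ replicate b 2) ! k + 2 * k) ` {a..<a + b}"
    by (simp add: spread_support_def index_list_two_var image_Un)
  also have "\<dots> = (\<lambda>k. 2 * k + 1) ` {..<a} \<union> (\<lambda>k. 2 * k + 2) ` {a..<a + b}"
    by (intro arg_cong2[where f = "(\<union>)"] image_cong) (auto simp: nth_append)
  finally show ?thesis .
qed

lemma polar_support_two_var: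
  "polar_support 2 (two_var a b) = (\<lambda>k. 2 * k + 1) ` {..<a} \<union> (\<lambda>k. 2 * k + 2) ` {..<b}"
proof -
  have "{1..2} = {1, 2::nat}" by auto
  then show ?thesis by (auto simp: polar_support_def lookup_two_var image_iff)
qed

section \<open>Straightening a chain of sets\<close>

lemma transp_steps:
  assumes "transp R" "\<forall>i\<in>{1..<m}. R (f i) (f (i + 1))" "1 \<le> i" "i < j" "j \<le> m"
  shows "R (f i) (f (j::nat))"
  using assms(4,5)
proof (induction j)
  case (Suc j)
  have step: "R (f j) (f (Suc j))" using Suc.prems assms(2,3) by auto
  show ?case
  proof (cases "i = j")
    case False
    then have "R (f i) (f j)" using Suc by simp
    then show ?thesis using step by (rule transpD[OF assms(1)])
  qed (use step in simp)
qed simp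

text \<open>
  Number the smallest set of the chain first, then the new elements of the next one, and so on. In
  the induction the largest set of the chain takes over the role of \<open>B\<close>, and the numbering obtained
  for it is continued on the rest of \<open>B\<close>.
\<close>

lemma chain_to_initial_segments:
  fixes A :: "nat \<Rightarrow> 'a set"
  assumes "finite B" "\<And>i. i \<in> {1..m} \<Longrightarrow> A i \<subseteq> B" "\<And>i j. 1 \<le> i \<Longrightarrow> i < j \<Longrightarrow> j \<le> m \<Longrightarrow> A i \<subseteq> A j"
  shows "\<exists>f. bij_betw f B {..<card B} \<and> (\<forall>i\<in>{1..m}. f ` A i = {..<card (A i)})"
  using assms
proof (induction m arbitrary: B)
  case 0
  then show ?case using ex_bij_betw_finite_nat[of B] by (auto simp: atLeast0LessThan)
next
  case (Suc m)
  let ?C = "A (Suc m)"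
  have C: "?C \<subseteq> B" using Suc.prems(2) by simp
  have finC: "finite ?C" using C Suc.prems(1) by (rule finite_subset)
  obtain f where f: "bij_betw f ?C {..<card ?C}" "\<forall>i\<in>{1..m}. f ` A i = {..<card (A i)}"
    using Suc.IH[OF finC] Suc.prems(3) by force
  have le: "card ?C \<le> card B" using Suc.prems(1) C by (rule card_mono)
  have "card (B - ?C) = card {card ?C..<card B}" using C finC by (simp add: card_Diff_subset)
  then obtain g where g: "bij_betw g (B - ?C) {card ?C..<card B}"
    using Suc.prems(1) finite_same_card_bij[of "B - ?C" "{card ?C..<card B}"] by auto
  let ?h = "\<lambda>x. if x \<in> ?C then f x else g x"
  have "bij_betw ?h (?C \<union> (B - ?C)) ({..<card ?C} \<union> {card ?C..<card B})"
    using f(1) g by (intro bij_betw_disjoint_Un) auto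
  moreover have "?C \<union> (B - ?C) = B" "{..<card ?C} \<union> {card ?C..<card B} = {..<card B}"
    using C le by auto
  moreover have "?h ` A i = {..<card (A i)}" if i: "i \<in> {1..Suc m}" for i
  proof -
    have "A i \<subseteq> ?C" using Suc.prems(3)[of i "Suc m"] i by (cases "i = Suc m") auto
    then have "?h ` A i = f ` A i" by (intro image_cong) auto
    then show ?thesis using f i by (cases "i = Suc m") (auto simp: bij_betw_def)
  qed
  ultimately show ?case by (intro exI[of _ ?h]) simp
qed

lemma chain_permutation:
  fixes A :: "nat \<Rightarrow> nat set" and m d :: nat
  assumes "\<And>i. i \<in> {1..m} \<Longrightarrow> A i \<subseteq> {..<d}"
    and "\<And>i j. 1 \<le> i \<Longrightarrow> i < j \<Longrightarrow> j \<le> m \<Longrightarrow> A i \<subseteq> A j"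
  obtains \<pi> where "\<pi> permutes {..<d}" "\<forall>i\<in>{1..m}. \<pi> ` A i = {..<card (A i)}"
proof -
  obtain f where f: "bij_betw f {..<d} {..<d}" "\<forall>i\<in>{1..m}. f ` A i = {..<card (A i)}"
    using chain_to_initial_segments[of "{..<d}" m A] assms by auto
  define \<pi> where "\<pi> = (\<lambda>x. if x \<in> {..<d} then f x else x)"
  have "bij_betw \<pi> {..<d} {..<d}"
    using f(1) by (subst bij_betw_cong[of _ _ f]) (simp_all add: \<pi>_def)
  then have "\<pi> permutes {..<d}" by (rule bij_imp_permutes) (simp add: \<pi>_def)
  moreover have "\<pi> ` A i = {..<card (A i)}" if "i \<in> {1..m}" for i
  proof -
    have "\<pi> ` A i = f ` A i" using assms(1)[OF that] by (intro image_cong) (auto simp: \<pi>_def)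
    then show ?thesis using f(2) that by simp
  qed
  ultimately show ?thesis using that by blast
qed

text \<open>
  Indices start at 1, so the even positions are \<open>2k + 2\<close>; the index 0 must stay fixed and needs its own
  case, as truncated subtraction would confuse it with the index 2.
\<close>

lemma permutation_on_evens:
  assumes "\<pi> permutes {..<d}"
  obtains \<tau> where "\<tau> permutes {1..2 * d}" "\<And>j. [\<tau> j = j] (mod 2)"
    "\<And>k. \<tau> (2 * k + 1) = 2 * k + 1" "\<And>k. \<tau> (2 * k + 2) = 2 * \<pi> k + (2::nat)"
proof -
  define L where "L = (\<lambda>\<rho>::nat\<Rightarrow>nat. \<lambda>x. if even x \<and> x > 0 then 2 * \<rho> ((x - 2) div 2) + 2 else x)"
  have even: "L \<rho> (2 * k + 2) = 2 * \<rho> k + 2" for \<rho> k by (simp add: L_def)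
  have cases: "x = 0 \<or> (\<exists>k. x = 2 * k + 1) \<or> (\<exists>k. x = 2 * k + 2)" for x :: nat by presburger
  have comp: "L \<rho> (L \<rho>' x) = x" if "\<rho> \<circ> \<rho>' = id" for \<rho> \<rho>' x
    using cases[of x] that by (auto simp: L_def fun_eq_iff)
  have "bij (L \<pi>)"
    using comp[OF permutes_inv_o(1)[OF assms]] comp[OF permutes_inv_o(2)[OF assms]]
    by (intro o_bij[of "L (inv_into UNIV \<pi>)"]) (auto simp: fun_eq_iff)
  moreover have "L \<pi> x = x" if "x \<notin> {1..2 * d}" for x
    using cases[of x] that permutes_not_in[OF assms] by (auto simp: L_def)
  ultimately have "L \<pi> permutes {1..2 * d}"
    by (simp add: permutes_def bij_iff)
  moreover have "[L \<pi> j = j] (mod 2)" for j by (auto simp: L_def cong_def even_iff_mod_2_eq_zero)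
  ultimately show ?thesis using even by (intro that[of "L \<pi>"]) (auto simp: L_def)
qed

section \<open>Smoothly spreadable ideals in two variables\<close>

theorem proposition1p13:
  fixes a b :: "nat \<Rightarrow> nat" and m :: nat and I :: "'k::field polynomial set"
  assumes "m \<ge> 1"
    and "\<forall>i\<in>{1..<m}. a i > a (i + 1)"
    and "\<forall>i\<in>{1..<m}. b i < b (i + 1)"
    and "I = Idl\<^bsub>T 2\<^esub> ((\<lambda>i. var 1 ^ a i * var 2 ^ b i) ` {1..m})"
  shows "((\<forall>i\<in>{1..<m}. a i + b i \<le> a (i + 1) + b (i + 1)) \<and> a m + b m > 0
            \<longrightarrow> smoothly_spreadable 2 I) \<and>
         (smoothly_spreadable 2 I \<longrightarrow>
            (\<forall>i. 2 \<le> i \<and> i + 1 \<le> m - 1 \<longrightarrow> a i + b i \<le> a (i + 1) + b (i + 1)) \<and>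
            (m \<ge> 2 \<and> b 1 > 0 \<longrightarrow> a 1 + b 1 \<le> a 2 + b 2) \<and>
            (m \<ge> 3 \<and> a m > 0 \<longrightarrow> a (m - 1) + b (m - 1) \<le> a m + b m))"
proof -
  let ?u = "\<lambda>i. two_var (a i) (b i)"
  define S where "S = ?u ` {1..m}"
  have a_less: "a j < a i" and b_less: "b i < b j" if "1 \<le> i" "i < j" "j \<le> m" for i j
    using transp_steps[of "\<lambda>x y. y < x" m a i j] transp_steps[of "(<)" m b i j] that assms(2,3)
    by (auto simp: transp_def)
  have S: "S \<subseteq> monomials 2" by (auto simp: S_def two_var_in_monomials)
  have I: "I = Idl\<^bsub>T 2\<^esub> (mpoly_monom ` S)"
    by (simp add: assms(4) S_def image_image mpoly_monom_two_var)
  have G: "min_gens 2 I = S"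
    using S I
  proof (rule min_gens_antichain)
    fix u v assume "u \<in> S" "v \<in> S" "mdvd u v"
    then obtain i j where ij: "i \<in> {1..m}" "j \<in> {1..m}" "u = ?u i" "v = ?u j" "a i \<le> a j" "b i \<le> b j"
      by (auto simp: S_def mdvd_two_var)
    then have "i = j"
      using a_less[of i j] b_less[of j i] by (cases i j rule: linorder_cases) auto
    then show "u = v" using ij by simp
  qed
  have fin: "finite (min_gens 2 I)" by (simp add: G S_def)
  have mon: "monomial_ideal 2 I" using S I by (auto simp: monomial_ideal_def)
  define d where "d = ideal_deg 2 I"
  note iff = smoothly_spreadable_iff[OF zero_less_numeral fin, folded d_def]
  have spreadable: "smoothly_spreadable 2 I"
    if steps: "\<forall>i\<in>{1..<m}. a i + b i \<le> a (i + 1) + b (i + 1)"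
  proof -
    have mono: "a i + b i \<le> a j + b j" if "1 \<le> i" "i \<le> j" "j \<le> m" for i j
      using transp_steps[of "(\<le>)" m "\<lambda>i. a i + b i" i j] that steps
      by (cases "i = j") (auto simp: transp_def)
    have "d = Max ((\<lambda>i. a i + b i) ` {1..m})"
      by (simp add: d_def ideal_deg_def G S_def image_image mdeg_two_var)
    also have "\<dots> = a m + b m"
    proof (rule Max_eqI)
      fix y assume "y \<in> (\<lambda>i. a i + b i) ` {1..m}"
      then show "y \<le> a m + b m" using mono[of _ m] by auto
    qed (use assms(1) in auto)
    finally have d: "d = a m + b m" .
    have nested: "{a i..<a i + b i} \<subseteq> {a j..<a j + b j}" if "1 \<le> i" "i < j" "j \<le> m" for i j
      using a_less[OF that] mono[of i j] that by auto
    have bounded: "{a i..<a i + b i} \<subseteq> {..<d}" if "i \<in> {1..m}" for i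
      using that mono[of i m] by (auto simp: d)
    obtain \<pi> where \<pi>: "\<pi> permutes {..<d}"
      "\<forall>i\<in>{1..m}. \<pi> ` {a i..<a i + b i} = {..<card {a i..<a i + b i}}"
      using chain_permutation[of m "\<lambda>i. {a i..<a i + b i}" d] bounded nested by metis
    obtain \<tau> where \<tau>: "\<tau> permutes {1..2 * d}" "\<And>j. [\<tau> j = j] (mod 2)"
      "\<And>k. \<tau> (2 * k + 1) = 2 * k + 1" "\<And>k. \<tau> (2 * k + 2) = 2 * \<pi> k + 2"
      using permutation_on_evens[OF \<pi>(1)] by blast
    have "\<tau> ` spread_support 2 (?u i) = polar_support 2 (?u i)" if "i \<in> {1..m}" for i
    proof -
      have "{..<b i} = \<pi> ` {a i..<a i + b i}" using \<pi>(2) that by simp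
      then show ?thesis
        unfolding spread_support_two_var polar_support_two_var image_Un image_image \<tau>(3,4)
        by (simp add: image_image)
    qed
    moreover have "I \<noteq> {0}"
    proof -
      have "?u 1 \<in> S" using assms(1) by (simp add: S_def)
      then have "(mpoly_monom (?u 1) :: 'k polynomial) \<in> I"
        using S mdvd_refl by (auto simp: I mon_in_genideal[OF S])
      moreover have "(mpoly_monom (?u 1) :: 'k polynomial) \<noteq> 0"
        by (metis keys_zero keys_single insert_not_empty mpoly_monom_def one_neq_zero)
      ultimately show ?thesis by auto
    qed
    ultimately show ?thesis
      unfolding iff using mon \<tau>(1,2) by (intro conjI exI[of _ \<tau>]) (simp_all add: G S_def)
  qed
  have "a i + b i \<le> a (i + 1) + b (i + 1)"
    if ss: "smoothly_spreadable 2 I" and i: "1 \<le> i" "i < m" and pos: "b i > 0" for i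
  proof -
    obtain \<tau> where \<tau>: "\<tau> permutes {1..2 * d}" "\<forall>j\<in>{1..2 * d}. [\<tau> j = j] (mod 2)"
      "\<forall>u\<in>S. \<tau> ` spread_support 2 u = polar_support 2 u"
      using ss unfolding iff G by blast
    have im: "\<tau> ` spread_support 2 (?u j) = polar_support 2 (?u j)" if "j \<in> {1..m}" for j
      using that \<tau>(3) by (auto simp: S_def)
    \<comment> \<open>The largest even index in the \<open>i\<close>-th spread generator. Its image is again even and thus one of
      the first \<open>b i\<close> positive even numbers. These belong to the next polarization as well, and
      pulling back along \<open>\<tau>\<close> puts \<open>x\<close> into the next spread generator.\<close>
    define x where "x = 2 * (a i + b i - 1) + 2"
    have x: "x \<in> spread_support 2 (?u i)"
      using pos unfolding x_def spread_support_two_var by (intro UnI2 imageI) simp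
    have ui: "?u i \<in> S" using i by (auto simp: S_def)
    have "spread_support 2 (?u i) \<subseteq> {1..2 * d}"
      using ui S fin G by (intro spread_support_subset) (auto simp: d_def ideal_deg_def)
    then have "[\<tau> x = x] (mod 2)" using x \<tau>(2) by blast
    then have "even (\<tau> x)" by (simp add: cong_def x_def even_iff_mod_2_eq_zero)
    moreover have "\<tau> x \<in> polar_support 2 (?u i)" using x im[of i] i by auto
    ultimately have "\<tau> x \<in> (\<lambda>k. 2 * k + 2) ` {..<b i}"
      unfolding polar_support_two_var by (elim UnE) auto
    moreover have "b i < b (i + 1)" using assms(3) i by simp
    ultimately have "\<tau> x \<in> (\<lambda>k. 2 * k + 2) ` {..<b (i + 1)}"
      by (auto simp del: add_2_eq_Suc')
    then have "\<tau> x \<in> polar_support 2 (?u (i + 1))"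
      unfolding polar_support_two_var by (rule UnI2)
    then have "\<tau> x \<in> \<tau> ` spread_support 2 (?u (i + 1))" using im[of "i + 1"] i by simp
    then have "x \<in> spread_support 2 (?u (i + 1))"
      using permutes_inj[OF \<tau>(1)] by (simp add: inj_image_mem_iff)
    then consider k where "x = 2 * k + 1" | k where "x = 2 * k + 2" "k < a (i + 1) + b (i + 1)"
      unfolding spread_support_two_var by auto
    then show ?thesis
    proof cases
      case 1
      then show ?thesis by (simp add: x_def) presburger
    next
      case 2
      then show ?thesis using pos by (simp add: x_def)
    qed
  qed
  moreover have "b i > 0" if "2 \<le> i" "i \<le> m" for i
    using b_less[of 1 i] that by simp
  ultimately have step: "a i + b i \<le> a (i + 1) + b (i + 1)"
    if "smoothly_spreadable 2 I" "1 \<le> i" "i < m" "2 \<le> i \<or> b i > 0" for i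
    using that by auto
  have last: "a (m - 1) + b (m - 1) \<le> a m + b m" if "smoothly_spreadable 2 I" "m \<ge> 3"
  proof -
    have "m - 1 + 1 = m" "1 \<le> m - 1" "m - 1 < m" "2 \<le> m - 1" using that(2) by auto
    then show ?thesis using step[OF that(1), of "m - 1"] by simp
  qed
  show ?thesis
    using spreadable step step[of 1] last by (auto simp: numeral_2_eq_2)
qed

end
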